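(* Let $\Omega$ be a semigroup and let $\big((A,\{\mu_k\}_{k\geq1}),(M,\{\eta_k\}_{k\geq1}),\{R_\alpha\}_{\alpha\in\Omega}\big)$ be a strict homotopy relative Rota-Baxter family algebra over a field ${\bf k}$ of characteristic $0$. Then $(M,\{\theta_k\}_{k\geq1})$ is a Dend$_\infty$-family algebra, where $$(\theta_k)^{[r]}_{\alpha_1,\ldots,\alpha_k}(u_1,\ldots,u_k)=\eta_k\big(R_{\alpha_1}(u_1),\ldots,u_r,\ldots,R_{\alpha_k}(u_k)\big)$$ (the $r$-th argument is $u_r$, and the $j$-th argument is $R_{\alpha_j}(u_j)$ for $j\neq r$), for $k\geq1$, $[r]\in C_k$, $\alpha_1,\ldots,\alpha_k\in\Omega$ and $u_1,\ldots,u_k\in M$.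
   Context: All vector spaces and linear maps are over a field ${\bf k}$ of characteristic $0$; $\Omega$ is a semigroup. A subscript $\alpha_1,\ldots,\alpha_i\cdots\alpha_{i+l-1},\ldots,\alpha_n$ means that the labels $\alpha_i,\ldots,\alpha_{i+l-1}$ are replaced by their product in $\Omega$. An $A_\infty$-algebra is a graded vector space $A=\oplus_{i\in\mathbb{Z}}A_i$ with degree $1$ linear maps $\mu_k:A^{\otimes k}\to A$, $k\geq1$, satisfying for all $n\geq1$ and homogeneous $a_1,\ldots,a_n\in A$ $$\sum_{k+l=n+1}\sum_{i=1}^k(-1)^{|a_1|+\cdots+|a_{i-1}|}\mu_k\big(a_1,\ldots,a_{i-1},\mu_l(a_i,\ldots,a_{i+l-1}),a_{i+l},\ldots,a_n\big)=0.\quad( * )$$ A representation of it is a graded vector space $M$ with degree $1$ linear maps $\eta_k:\mathcal{A}^{k-1,1}\to M$, $k\geq1$, where $\mathcal{A}^{k-1,1}$ is the direct sum of all $k$-fold tensor products of copies of $A$ and $M$ with $A$ appearing $k-1$ times and $M$ exactly once, satisfying the identities $( * )$ whenever exactly one of $a_1,\ldots,a_n$ is from $M$ and the others are from $A$, with $\mu_k$ or $\mu_l$ replaced by $\eta_k$ or $\eta_l$ wherever the corresponding operation has an input from $M$. A strict homotopy relative Rota-Baxter family algebra is a triple $\big((A,\{\mu_k\}_{k\geq1}),(M,\{\eta_k\}_{k\geq1}),\{R_\alpha\}_{\alpha\in\Omega}\big)$ of an $A_\infty$-algebra, a representation of it, and a collection $\{R_\alpha:M\to A\}_{\alpha\in\Omega}$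 of degree $0$ linear maps satisfying $$\mu_k\big(R_{\alpha_1}(u_1),\ldots,R_{\alpha_k}(u_k)\big)=\sum_{r=1}^kR_{\alpha_1\cdots\alpha_k}\big(\eta_k(R_{\alpha_1}(u_1),\ldots,u_r,\ldots,R_{\alpha_k}(u_k))\big)$$ for all $k\geq1$, $\alpha_1,\ldots,\alpha_k\in\Omega$ and $u_1,\ldots,u_k\in M$. Dend$_\infty$-family algebra. Let $D=\oplus_{i\in\mathbb{Z}}D_i$ be a graded vector space and $C_n=\{[1],\ldots,[n]\}$ for $n\geq 1$. $\mathrm{Hom}^1_{\widehat\Omega}({\bf k}[C_k]\otimes D^{\otimes k},D)$ is the set of collections $\theta_k=\{(\theta_k)_{\alpha_1,\ldots,\alpha_k}:{\bf k}[C_k]\otimes D^{\otimes k}\to D\}_{\alpha_1,\ldots,\alpha_k\in\Omega}$ of linear maps such that, writing $(\theta_k)^{[r]}_{\alpha_1,\ldots,\alpha_k}:=(\theta_k)_{\alpha_1,\ldots,\alpha_k}([r];-,\ldots,-):D^{\otimes k}\to D$, each $(\theta_k)^{[r]}_{\alpha_1,\ldots,\alpha_k}$ has degree $1$ and does not depend on $\alpha_r$, for all $1\leq r\leq k$. A Dend$_\infty$-family algebra is a pair $(D,\{\theta_k\}_{k\geq1})$ with $\theta_k\in\mathrm{Hom}^1_{\widehat\Omega}({\bf k}[C_k]\otimes D^{\otimes k},D)$ satisfying, for all $n\geq1$, $[r]\in C_n$, $\alpha_1,\ldots,\alpha_n\in\Omega$ and homogeneous $x_1,\ldots,x_n\in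 D$, $$\sum_{k+l=n+1}\sum_{i=1}^k(\theta_k\diamond_i\theta_l)^{[r]}_{\alpha_1,\ldots,\alpha_n}(x_1,\ldots,x_n)=0,$$ where, with $\varepsilon=(-1)^{|x_1|+\cdots+|x_{i-1}|}$, $(\theta_k\diamond_i\theta_l)^{[r]}_{\alpha_1,\ldots,\alpha_n}(x_1,\ldots,x_n)$ equals - $\varepsilon\,(\theta_k)^{[r]}_{\alpha_1,\ldots,\alpha_i\cdots\alpha_{i+l-1},\ldots,\alpha_n}\big(x_1,\ldots,x_{i-1},\sum_{s=1}^l(\theta_l)^{[s]}_{\alpha_i,\ldots,\alpha_{i+l-1}}(x_i,\ldots,x_{i+l-1}),x_{i+l},\ldots,x_n\big)$ if $1\leq r\leq i-1$; - $\varepsilon\,(\theta_k)^{[i]}_{\alpha_1,\ldots,\alpha_i\cdots\alpha_{i+l-1},\ldots,\alpha_n}\big(x_1,\ldots,x_{i-1},(\theta_l)^{[r-i+1]}_{\alpha_i,\ldots,\alpha_{i+l-1}}(x_i,\ldots,x_{i+l-1}),x_{i+l},\ldots,x_n\big)$ if $i\leq r\leq i+l-1$; - $\varepsilon\,(\theta_k)^{[r-l+1]}_{\alpha_1,\ldots,\alpha_i\cdots\alpha_{i+l-1},\ldots,\alpha_n}\big(x_1,\ldots,x_{i-1},\sum_{s=1}^l(\theta_l)^{[s]}_{\alpha_i,\ldots,\alpha_{i+l-1}}(x_i,\ldots,x_{i+l-1}),x_{i+l},\ldots,x_n\big)$ if $i+l\leq r\leq n$. *)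

theory Defs
  imports Complex_Main
begin

locale graded_vector_space = vector_space scale
  for scale :: "'k::field_char_0 \<Rightarrow> 'v::ab_group_add \<Rightarrow> 'v" +
  fixes V :: "int \<Rightarrow> 'v set"
  assumes subspace_component: "subspace (V d)"
    and direct_sum: "\<exists>!f. (\<forall>d. f d \<in> V d) \<and> finite {d. f d \<noteq> 0} \<and> v = (\<Sum>d | f d \<noteq> 0. f d)"

text \<open>A linear map out of a tensor power is encoded as the corresponding multilinear map, taken
  on lists of arguments; values on lists of a different length are irrelevant. Positions in lists
  are counted from 1, so the entry at position j is xs ! (j - 1).\<close>

definition multilinear ::
  "('k::field \<Rightarrow> 'v::ab_group_add \<Rightarrow> 'v) \<Rightarrow> ('k \<Rightarrow> 'w::ab_group_add \<Rightarrow> 'w) \<Rightarrow> nat \<Rightarrow> ('v list \<Rightarrow> 'w) \<Rightarrow> bool"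
  where "multilinear s t k f \<longleftrightarrow>
    (\<forall>xs ys. length xs + 1 + length ys = k \<longrightarrow> Vector_Spaces.linear s t (\<lambda>v. f (xs @ v # ys)))"

text \<open>The list ds gives degrees of the entries of xs. Degrees are explicit data because the zero
  vector lies in every component.\<close>

definition homogeneous :: "(int \<Rightarrow> 'v set) \<Rightarrow> int list \<Rightarrow> 'v list \<Rightarrow> bool"
  where "homogeneous V ds xs \<longleftrightarrow> list_all2 (\<lambda>d x. x \<in> V d) ds xs"

definition degree_one :: "(int \<Rightarrow> 'v set) \<Rightarrow> (int \<Rightarrow> 'w set) \<Rightarrow> nat \<Rightarrow> ('v list \<Rightarrow> 'w) \<Rightarrow> bool"
  where "degree_one V W k f \<longleftrightarrow>
    (\<forall>ds xs. length xs = k \<longrightarrow> homogeneous V ds xs \<longrightarrow> f xs \<in> W (sum_list ds + 1))"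

definition koszul_sign :: "nat \<Rightarrow> int list \<Rightarrow> 'k::field"
  where "koszul_sign i ds = (- 1) powi sum_list (take (i - 1) ds)"

definition splits :: "nat \<Rightarrow> (nat \<times> nat) set"
  where "splits n = {(k, l). 1 \<le> k \<and> 1 \<le> l \<and> k + l = n + 1}"

lemma finite_splits: "finite (splits n)"
  by (rule finite_subset[of _ "{..n + 1} \<times> {..n + 1}"]) (auto simp: splits_def)

text \<open>The entries at positions i, ..., i + l - 1 are replaced by the single entry that f assigns
  to them.\<close>

definition contract :: "nat \<Rightarrow> nat \<Rightarrow> ('x list \<Rightarrow> 'x) \<Rightarrow> 'x list \<Rightarrow> 'x list"
  where "contract i l f xs = take (i - 1) xs @ f (take l (drop (i - 1) xs)) # drop (i + l - 1) xs"

locale A_infinity_algebra = graded_vector_space scale A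
  for scale :: "'k::field_char_0 \<Rightarrow> 'a::ab_group_add \<Rightarrow> 'a" and A :: "int \<Rightarrow> 'a set" +
  fixes \<mu> :: "nat \<Rightarrow> 'a list \<Rightarrow> 'a"
  assumes multilinear_mu: "1 \<le> k \<Longrightarrow> multilinear scale scale k (\<mu> k)"
    and degree_mu: "1 \<le> k \<Longrightarrow> degree_one A A k (\<mu> k)"
    and A_infinity: "1 \<le> n \<Longrightarrow> length as = n \<Longrightarrow> homogeneous A ds as \<Longrightarrow>
      (\<Sum>(k, l)\<in>splits n. \<Sum>i = 1..k.
        scale (koszul_sign i ds) (\<mu> k (contract i l (\<mu> l) as))) = 0"

text \<open>A word with entries in A and M is a list over the sum type, with Inl marking the entries
  from A and Inr those from M.\<close>

definition M_count :: "('a + 'm) list \<Rightarrow> nat"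
  where "M_count xs = length (filter (\<lambda>x. \<not> isl x) xs)"

text \<open>A linear map on the direct sum of the tensor products with exactly one factor M is a map on
  the words with exactly one entry from M that is linear in each entry.\<close>

definition mixed_multilinear ::
  "('k::field \<Rightarrow> 'a::ab_group_add \<Rightarrow> 'a) \<Rightarrow> ('k \<Rightarrow> 'm::ab_group_add \<Rightarrow> 'm) \<Rightarrow> nat \<Rightarrow>
    (('a + 'm) list \<Rightarrow> 'm) \<Rightarrow> bool"
  where "mixed_multilinear s t k f \<longleftrightarrow>
    (\<forall>xs ys. length xs + 1 + length ys = k \<longrightarrow>
      (M_count (xs @ ys) = 1 \<longrightarrow> Vector_Spaces.linear s t (\<lambda>a. f (xs @ Inl a # ys))) \<and>
      (M_count (xs @ ys) = 0 \<longrightarrow> Vector_Spaces.linear t t (\<lambda>u. f (xs @ Inr u # ys))))"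

definition mixed_degree_one ::
  "(int \<Rightarrow> 'a set) \<Rightarrow> (int \<Rightarrow> 'm set) \<Rightarrow> nat \<Rightarrow> (('a + 'm) list \<Rightarrow> 'm) \<Rightarrow> bool"
  where "mixed_degree_one A M k f \<longleftrightarrow>
    (\<forall>ds xs. length xs = k \<longrightarrow> M_count xs = 1 \<longrightarrow> homogeneous (\<lambda>d. A d <+> M d) ds xs \<longrightarrow>
      f xs \<in> M (sum_list ds + 1))"

definition mixed_op ::
  "(nat \<Rightarrow> 'a list \<Rightarrow> 'a) \<Rightarrow> (nat \<Rightarrow> ('a + 'm) list \<Rightarrow> 'm) \<Rightarrow> nat \<Rightarrow> ('a + 'm) list \<Rightarrow> 'a + 'm"
  where "mixed_op \<mu> \<eta> l xs =
    (if M_count xs = 0 then Inl (\<mu> l (map projl xs)) else Inr (\<eta> l xs))"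

text \<open>In the identities below the outer operation always has an input from M, so only the inner
  one can be an operation of A.\<close>

locale A_infinity_representation =
  alg: A_infinity_algebra scaleA A \<mu> + rep: graded_vector_space scaleM M
  for scaleA :: "'k::field_char_0 \<Rightarrow> 'a::ab_group_add \<Rightarrow> 'a" and A :: "int \<Rightarrow> 'a set"
    and \<mu> :: "nat \<Rightarrow> 'a list \<Rightarrow> 'a"
    and scaleM :: "'k \<Rightarrow> 'm::ab_group_add \<Rightarrow> 'm" and M :: "int \<Rightarrow> 'm set" +
  fixes \<eta> :: "nat \<Rightarrow> ('a + 'm) list \<Rightarrow> 'm"
  assumes multilinear_eta: "1 \<le> k \<Longrightarrow> mixed_multilinear scaleA scaleM k (\<eta> k)"
    and degree_eta: "1 \<le> k \<Longrightarrow> mixed_degree_one A M k (\<eta> k)"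
    and representation: "1 \<le> n \<Longrightarrow> length xs = n \<Longrightarrow> M_count xs = 1 \<Longrightarrow>
      homogeneous (\<lambda>d. A d <+> M d) ds xs \<Longrightarrow>
      (\<Sum>(k, l)\<in>splits n. \<Sum>i = 1..k.
        scaleM (koszul_sign i ds) (\<eta> k (contract i l (mixed_op \<mu> \<eta> l) xs))) = 0"

text \<open>Product of a nonempty list; a semigroup need not have a unit.\<close>

fun sg_prod :: "'w::semigroup_mult list \<Rightarrow> 'w"
  where
    "sg_prod [\<alpha>] = \<alpha>"
  | "sg_prod (\<alpha> # \<beta> # \<alpha>s) = \<alpha> * sg_prod (\<beta> # \<alpha>s)"

text \<open>The word with the vector us ! (r - 1) of M at position r and the image of us ! (j - 1) under
  the operator R labelled by \<open>\<alpha>s ! (j - 1)\<close> at every other position j.\<close>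

definition RB_word :: "('w \<Rightarrow> 'm \<Rightarrow> 'a) \<Rightarrow> nat \<Rightarrow> 'w list \<Rightarrow> 'm list \<Rightarrow> ('a + 'm) list"
  where "RB_word R r \<alpha>s us =
    map (\<lambda>j. if j = r then Inr (us ! (j - 1)) else Inl (R (\<alpha>s ! (j - 1)) (us ! (j - 1))))
      [1..<length us + 1]"

locale strict_homotopy_relative_RB_family_algebra =
  A_infinity_representation scaleA A \<mu> scaleM M \<eta>
  for scaleA :: "'k::field_char_0 \<Rightarrow> 'a::ab_group_add \<Rightarrow> 'a" and A :: "int \<Rightarrow> 'a set"
    and \<mu> :: "nat \<Rightarrow> 'a list \<Rightarrow> 'a"
    and scaleM :: "'k \<Rightarrow> 'm::ab_group_add \<Rightarrow> 'm" and M :: "int \<Rightarrow> 'm set"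
    and \<eta> :: "nat \<Rightarrow> ('a + 'm) list \<Rightarrow> 'm" +
  fixes R :: "'w::semigroup_mult \<Rightarrow> 'm \<Rightarrow> 'a"
  assumes linear_R: "Vector_Spaces.linear scaleM scaleA (R \<alpha>)"
    and degree_R: "u \<in> M d \<Longrightarrow> R \<alpha> u \<in> A d"
    and Rota_Baxter: "1 \<le> k \<Longrightarrow> length \<alpha>s = k \<Longrightarrow> length us = k \<Longrightarrow>
      \<mu> k (map2 R \<alpha>s us) = (\<Sum>r = 1..k. R (sg_prod \<alpha>s) (\<eta> k (RB_word R r \<alpha>s us)))"

text \<open>A family of linear maps on the tensor product of the free vector space on [1], ..., [k] with
  the k-th tensor power is given by its components at the basis elements [r]:
  \<open>\<theta> k \<alpha>s r\<close> is the component of the k-th collection with labels \<open>\<alpha>s\<close> at [r].\<close>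

definition Hom_family ::
  "('k::field \<Rightarrow> 'v::ab_group_add \<Rightarrow> 'v) \<Rightarrow> (int \<Rightarrow> 'v set) \<Rightarrow> nat \<Rightarrow>
    ('w list \<Rightarrow> nat \<Rightarrow> 'v list \<Rightarrow> 'v) set"
  where "Hom_family s D k =
    {\<phi>. \<forall>\<alpha>s r. length \<alpha>s = k \<longrightarrow> 1 \<le> r \<longrightarrow> r \<le> k \<longrightarrow>
      multilinear s s k (\<phi> \<alpha>s r) \<and> degree_one D D k (\<phi> \<alpha>s r) \<and>
      (\<forall>\<beta> xs. length xs = k \<longrightarrow> \<phi> (\<alpha>s[r - 1 := \<beta>]) r xs = \<phi> \<alpha>s r xs)}"

text \<open>Here ds lists degrees of the entries of xs; it only enters through the sign.\<close>

definition diamond ::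
  "('k::field \<Rightarrow> 'v::ab_group_add \<Rightarrow> 'v) \<Rightarrow> (nat \<Rightarrow> 'w::semigroup_mult list \<Rightarrow> nat \<Rightarrow> 'v list \<Rightarrow> 'v) \<Rightarrow>
    nat \<Rightarrow> nat \<Rightarrow> nat \<Rightarrow> nat \<Rightarrow> 'w list \<Rightarrow> int list \<Rightarrow> 'v list \<Rightarrow> 'v"
  where "diamond s \<theta> k i l r \<alpha>s ds xs =
    (let \<alpha>s' = contract i l sg_prod \<alpha>s; \<beta>s = take l (drop (i - 1) \<alpha>s) in
      s (koszul_sign i ds)
        (if r \<le> i - 1 then \<theta> k \<alpha>s' r (contract i l (\<lambda>ys. \<Sum>p = 1..l. \<theta> l \<beta>s p ys) xs)
         else if r \<le> i + l - 1 then \<theta> k \<alpha>s' i (contract i l (\<theta> l \<beta>s (r - i + 1)) xs)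
         else \<theta> k \<alpha>s' (r - l + 1) (contract i l (\<lambda>ys. \<Sum>p = 1..l. \<theta> l \<beta>s p ys) xs)))"

locale Dend_infinity_family_algebra = graded_vector_space scale D
  for scale :: "'k::field_char_0 \<Rightarrow> 'v::ab_group_add \<Rightarrow> 'v" and D :: "int \<Rightarrow> 'v set" +
  fixes \<theta> :: "nat \<Rightarrow> 'w::semigroup_mult list \<Rightarrow> nat \<Rightarrow> 'v list \<Rightarrow> 'v"
  assumes Hom_theta: "1 \<le> k \<Longrightarrow> \<theta> k \<in> Hom_family scale D k"
    and Dend_infinity: "1 \<le> n \<Longrightarrow> 1 \<le> r \<Longrightarrow> r \<le> n \<Longrightarrow> length \<alpha>s = n \<Longrightarrow> length xs = n \<Longrightarrow>
      homogeneous D ds xs \<Longrightarrow>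
      (\<Sum>(k, l)\<in>splits n. \<Sum>i = 1..k. diamond scale \<theta> k i l r \<alpha>s ds xs) = 0"

end

theory Submission
  imports Defs
begin

text \<open>The Dend-infinity identity at [r] is the representation identity for the word whose r-th entry
  is the vector from M, and this holds summand by summand. If the inner operation meets the M-entry,
  it is \<open>\<eta>\<close>. Otherwise it is \<open>\<mu>\<close> applied to images under R, which by the Rota-Baxter identity is
  R of the sum of the inner components, labelled by the product.\<close>

section \<open>Cutting lists at a segment; words with one marked entry\<close>

lemma contract_append:
  assumes "length xs = i - 1" "length ys = l" "1 \<le> i"
  shows "contract i l f (xs @ ys @ zs) = xs @ f ys # zs"
  using assms by (simp add: contract_def)

lemma split_segment:
  assumes "1 \<le> i" "i + l \<le> length xs + 1"
  obtains us vs ws where "xs = us @ vs @ ws" "length us = i - 1" "length vs = l"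
proof
  show "xs = take (i - 1) xs @ take l (drop (i - 1) xs) @ drop l (drop (i - 1) xs)"
    by (simp only: append_take_drop_id)
qed (use assms in auto)

text \<open>Marking position 0, or a position beyond the end, marks nothing. Truncated subtraction
  therefore gives the correct position for the tail of a word also when the mark lies before it.\<close>

lemma RB_word_Cons:
  "RB_word R r (\<alpha> # \<alpha>s) (u # us) =
    (if r = 1 then Inr u else Inl (R \<alpha> u)) # RB_word R (r - 1) \<alpha>s us"
  by (rule nth_equalityI) (auto simp: RB_word_def nth_Cons' simp del: upt_Suc)

lemma RB_word_Nil [simp]: "RB_word R r \<alpha>s [] = []"
  by (simp add: RB_word_def)

lemma length_RB_word [simp]: "length (RB_word R r \<alpha>s us) = length us"
  by (simp add: RB_word_def del: upt_Suc)

lemma RB_word_append: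
  "length \<alpha>s = length us \<Longrightarrow>
    RB_word R r (\<alpha>s @ \<beta>s) (us @ vs) = RB_word R r \<alpha>s us @ RB_word R (r - length us) \<beta>s vs"
  by (induction \<alpha>s us arbitrary: r rule: list_induct2) (simp_all add: RB_word_Cons)

lemma RB_word_unmarked:
  "length \<alpha>s = length us \<Longrightarrow> r = 0 \<or> length us < r \<Longrightarrow>
    RB_word R r \<alpha>s us = map Inl (map2 R \<alpha>s us)"
  by (induction \<alpha>s us arbitrary: r rule: list_induct2) (auto simp: RB_word_Cons)

text \<open>The label at the marked position is never read, since the entry there is the bare
  vector. This is why the component at \<open>[r]\<close> does not depend on the label
  \<open>\<alpha>s ! (r - 1)\<close>.\<close>

lemma RB_word_update:
  "1 \<le> r \<Longrightarrow> RB_word R r (\<alpha>s[r - 1 := \<beta>]) us = RB_word R r \<alpha>s us"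
  by (auto simp: RB_word_def nth_list_update_neq simp del: upt_Suc)

lemma M_count_simps [simp]:
  "M_count [] = 0" "M_count (Inl a # xs) = M_count xs" "M_count (Inr u # xs) = Suc (M_count xs)"
  "M_count (xs @ ys) = M_count xs + M_count ys" "M_count (map Inl as) = 0"
  by (auto simp: M_count_def filter_empty_conv)

lemma M_count_RB_word:
  "length \<alpha>s = length us \<Longrightarrow>
    M_count (RB_word R r \<alpha>s us) = (if 1 \<le> r \<and> r \<le> length us then 1 else 0)"
  by (induction \<alpha>s us arbitrary: r rule: list_induct2) (auto simp: RB_word_Cons)

text \<open>The maps \<open>R \<alpha>\<close> have degree 0, so the word keeps the degree list
  \<open>ds\<close> of \<open>us\<close>. Hence the same Koszul signs occur in the representation
  identity and in the Dend-infinity identity.\<close>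

lemma homogeneous_RB_word:
  assumes "homogeneous M ds us" "length \<alpha>s = length us" "\<And>\<alpha> d u. u \<in> M d \<Longrightarrow> R \<alpha> u \<in> A d"
  shows "homogeneous (\<lambda>d. A d <+> M d) ds (RB_word R r \<alpha>s us)"
  using assms(2,1,3) unfolding homogeneous_def
  by (induction \<alpha>s us arbitrary: r ds rule: list_induct2)
    (auto simp: RB_word_Cons list_all2_Cons2)

section \<open>Multilinearity and degree of the components\<close>

context strict_homotopy_relative_RB_family_algebra
begin

lemma multilinear_RB:
  assumes "length \<alpha>s = k" "1 \<le> r" "r \<le> k"
  shows "multilinear scaleM scaleM k (\<lambda>us. \<eta> k (RB_word R r \<alpha>s us))"
  unfolding multilinear_def
proof (intro allI impI)
  fix xs ys :: "'m list"
  assume len: "length xs + 1 + length ys = k"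
  \<comment> \<open>A segment of length 1 at position \<open>length xs + 1\<close> isolates the
    label of the varying argument.\<close>
  obtain \<beta>s \<gamma>s \<delta>s where \<alpha>s: "\<alpha>s = \<beta>s @ \<gamma>s @ \<delta>s" "length \<beta>s = length xs" "length \<gamma>s = 1"
    using split_segment[of "length xs + 1" 1 \<alpha>s] assms len by auto
  then obtain \<gamma> where \<gamma>: "\<gamma>s = [\<gamma>]"
    by (auto simp: length_Suc_conv)
  have len_\<delta>: "length \<delta>s = length ys"
    using \<alpha>s \<gamma> len assms by simp
  let ?X = "RB_word R r \<beta>s xs" and ?Y = "RB_word R (r - length xs - 1) \<delta>s ys"
  have word: "RB_word R r \<alpha>s (xs @ v # ys) =
      ?X @ (if r = length xs + 1 then Inr v else Inl (R \<gamma> v)) # ?Y" for v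
    using \<alpha>s \<gamma> by (auto simp: RB_word_append RB_word_Cons)
  have lin: "length ?X + 1 + length ?Y = k"
    using len by simp
  have eta: "mixed_multilinear scaleA scaleM k (\<eta> k)"
    using multilinear_eta assms by simp
  show "Vector_Spaces.linear scaleM scaleM (\<lambda>v. \<eta> k (RB_word R r \<alpha>s (xs @ v # ys)))"
  proof (cases "r = length xs + 1")
    case True
    then have "M_count (?X @ ?Y) = 0"
      using \<alpha>s len_\<delta> by (simp add: M_count_RB_word)
    with eta lin True show ?thesis
      unfolding mixed_multilinear_def word by simp
  next
    case False
    then have "M_count (?X @ ?Y) = 1"
      using \<alpha>s len_\<delta> assms len by (auto simp: M_count_RB_word)
    with eta lin have "Vector_Spaces.linear scaleA scaleM (\<lambda>a. \<eta> k (?X @ Inl a # ?Y))"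
      unfolding mixed_multilinear_def by blast
    \<comment> \<open>At an unmarked position \<open>v\<close> enters only through
      \<open>R \<gamma>\<close>, so the map is a composite of two linear maps.\<close>
    from Vector_Spaces.linear_compose[OF linear_R this] False show ?thesis
      unfolding word by (simp add: o_def)
  qed
qed

lemma degree_one_RB:
  assumes "length \<alpha>s = k" "1 \<le> r" "r \<le> k"
  shows "degree_one M M k (\<lambda>us. \<eta> k (RB_word R r \<alpha>s us))"
  unfolding degree_one_def
proof (intro allI impI)
  fix ds and us :: "'m list"
  assume us: "length us = k" "homogeneous M ds us"
  have "homogeneous (\<lambda>d. A d <+> M d) ds (RB_word R r \<alpha>s us)"
    using us assms by (intro homogeneous_RB_word) (auto intro: degree_R)
  moreover have "M_count (RB_word R r \<alpha>s us) = 1"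
    using us assms by (simp add: M_count_RB_word)
  ultimately show "\<eta> k (RB_word R r \<alpha>s us) \<in> M (sum_list ds + 1)"
    using degree_eta[of k] us assms unfolding mixed_degree_one_def by simp
qed

lemma Hom_family_RB:
  assumes "1 \<le> k"
  shows "(\<lambda>\<alpha>s r us. \<eta> k (RB_word R r \<alpha>s us)) \<in> Hom_family scaleM M k"
  unfolding Hom_family_def
  \<comment> \<open>The simplifier turns \<open>r - 1\<close> into \<open>r - Suc 0\<close>; the
    rule is restated in that form so that it still matches.\<close>
  by (auto simp: RB_word_update[unfolded One_nat_def] intro: multilinear_RB degree_one_RB)

section \<open>Comparison of the two identities summand by summand\<close>

lemma mixed_op_unmarked:
  assumes "length \<beta>s = l" "length vs = l" "1 \<le> l" "r = 0 \<or> l < r"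
  shows "mixed_op \<mu> \<eta> l (RB_word R r \<beta>s vs) =
    Inl (R (sg_prod \<beta>s) (\<Sum>p = 1..l. \<eta> l (RB_word R p \<beta>s vs)))"
proof -
  have "mixed_op \<mu> \<eta> l (RB_word R r \<beta>s vs) = Inl (\<mu> l (map2 R \<beta>s vs))"
    \<comment> \<open>The two maps must stay separate until \<open>M_count\<close> has recognized a
      word of the form \<open>map Inl as\<close>. Only then are they fused, to cancel
      \<open>projl\<close> against \<open>Inl\<close>.\<close>
    using assms by (simp add: RB_word_unmarked mixed_op_def del: map_map) (simp add: o_def)
  \<comment> \<open>The Rota-Baxter identity, with \<open>R (sg_prod \<beta>s)\<close> taken out of
    the sum by linearity.\<close>
  also have "\<mu> l (map2 R \<beta>s vs) = R (sg_prod \<beta>s) (\<Sum>p = 1..l. \<eta> l (RB_word R p \<beta>s vs))"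
    using Rota_Baxter[of l \<beta>s vs] assms
    by (simp add: module_hom.sum[OF linear_R[unfolded linear_iff_module_hom]])
  finally show ?thesis .
qed

lemma mixed_op_marked:
  assumes "length \<beta>s = length vs" "1 \<le> r" "r \<le> length vs"
  shows "mixed_op \<mu> \<eta> l (RB_word R r \<beta>s vs) = Inr (\<eta> l (RB_word R r \<beta>s vs))"
  using assms by (simp add: mixed_op_def M_count_RB_word)

text \<open>Both words are cut before and after the contracted segment and compared piece by piece.
  The three cases in \<open>diamond\<close> record whether the mark \<open>r\<close> lies before,
  inside or after the segment.\<close>

lemma diamond_RB:
  assumes len: "length \<alpha>s = n" "length us = n" and kl: "(k, l) \<in> splits n"
    and i: "1 \<le> i" "i \<le> k" and r: "1 \<le> r" "r \<le> n"
  shows "diamond scaleM (\<lambda>k \<alpha>s r us. \<eta> k (RB_word R r \<alpha>s us)) k i l r \<alpha>s ds us =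
    scaleM (koszul_sign i ds) (\<eta> k (contract i l (mixed_op \<mu> \<eta> l) (RB_word R r \<alpha>s us)))"
proof -
  have l: "1 \<le> l" "i + l \<le> n + 1"
    using kl i by (auto simp: splits_def)
  obtain \<alpha>1 \<alpha>2 \<alpha>3 where \<alpha>: "\<alpha>s = \<alpha>1 @ \<alpha>2 @ \<alpha>3" "length \<alpha>1 = i - 1" "length \<alpha>2 = l"
    using split_segment[of i l \<alpha>s] i l len by auto
  obtain u1 u2 u3 where u: "us = u1 @ u2 @ u3" "length u1 = i - 1" "length u2 = l"
    using split_segment[of i l us] i l len by auto
  have len3: "length \<alpha>3 = length u3"
    using \<alpha> u len by simp
  have seg: "take l (drop (i - 1) \<alpha>s) = \<alpha>2"
    using \<alpha> by simp
  have inner: "contract i l (mixed_op \<mu> \<eta> l) (RB_word R r \<alpha>s us) =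
      RB_word R r \<alpha>1 u1 @ mixed_op \<mu> \<eta> l (RB_word R (r - (i - 1)) \<alpha>2 u2)
        # RB_word R (r - (i - 1) - l) \<alpha>3 u3"
    using \<alpha> u i by (simp add: RB_word_append contract_append)
  \<comment> \<open>The contracted segment is now the single position \<open>i\<close>, so the mark
    in the tail is \<open>r' - i\<close>. The three cases use this with \<open>r'\<close> equal to
    \<open>r\<close>, \<open>i\<close> and \<open>r - l + 1\<close>.\<close>
  have outer: "RB_word R r' (contract i l sg_prod \<alpha>s) (contract i l f us) =
      RB_word R r' \<alpha>1 u1 @ (if r' = i then Inr (f u2) else Inl (R (sg_prod \<alpha>2) (f u2)))
        # RB_word R (r' - i) \<alpha>3 u3" for r' f
    using \<alpha> u i by (auto simp: RB_word_append RB_word_Cons contract_append)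
  consider "r \<le> i - 1" | "i \<le> r" "r \<le> i + l - 1" | "i + l \<le> r"
    by linarith
  then show ?thesis
  proof cases
    case 1
    then have "mixed_op \<mu> \<eta> l (RB_word R (r - (i - 1)) \<alpha>2 u2) =
        Inl (R (sg_prod \<alpha>2) (\<Sum>p = 1..l. \<eta> l (RB_word R p \<alpha>2 u2)))"
      using \<alpha> u l by (intro mixed_op_unmarked) auto
    \<comment> \<open>Both differences truncate to 0: the tail is unmarked in both words.\<close>
    moreover have "r - (i - 1) - l = r - i" "r \<noteq> i"
      using 1 i r by auto
    ultimately show ?thesis
      using 1 by (simp only: diamond_def Let_def seg inner outer if_True if_False)
  next
    case 2
    then have "mixed_op \<mu> \<eta> l (RB_word R (r - (i - 1)) \<alpha>2 u2) =
        Inr (\<eta> l (RB_word R (r - i + 1) \<alpha>2 u2))"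
      using \<alpha> u i mixed_op_marked[of \<alpha>2 u2 "r - i + 1" l] by (simp add: Suc_diff_le)
    \<comment> \<open>Both marks lie beyond the \<open>i - 1\<close> entries of \<open>u1\<close>,
      so neither marks anything there.\<close>
    moreover have "RB_word R r \<alpha>1 u1 = RB_word R i \<alpha>1 u1"
      using 2 \<alpha> u i by (simp add: RB_word_unmarked)
    \<comment> \<open>The zero is written as \<open>i - i\<close> to match \<open>outer\<close> at
      \<open>r' = i\<close>.\<close>
    moreover have "r - (i - 1) - l = i - i" "\<not> r \<le> i - 1"
      using 2 i by auto
    ultimately show ?thesis
      using 2 by (simp only: diamond_def Let_def seg inner outer if_True if_False simp_thms)
  next
    case 3
    have "mixed_op \<mu> \<eta> l (RB_word R (r - (i - 1)) \<alpha>2 u2) =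
        Inl (R (sg_prod \<alpha>2) (\<Sum>p = 1..l. \<eta> l (RB_word R p \<alpha>2 u2)))"
      using 3 \<alpha> u i l by (intro mixed_op_unmarked) auto
    moreover have "RB_word R r \<alpha>1 u1 = RB_word R (r - l + 1) \<alpha>1 u1"
      using 3 \<alpha> u i by (simp add: RB_word_unmarked)
    \<comment> \<open>Replacing \<open>l\<close> entries by one shifts the mark to
      \<open>r - l + 1\<close>, which exceeds \<open>i\<close>; its place within the tail is
      unchanged.\<close>
    moreover have "r - (i - 1) - l = r - l + 1 - i" "\<not> r \<le> i - 1" "\<not> r \<le> i + l - 1"
        "r - l + 1 \<noteq> i"
      using 3 i l by auto
    ultimately show ?thesis
      by (simp only: diamond_def Let_def seg inner outer if_False)
  qed
qed

lemma Dend_infinity_RB: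
  assumes "1 \<le> n" "1 \<le> r" "r \<le> n" "length \<alpha>s = n" "length us = n" "homogeneous M ds us"
  shows "(\<Sum>(k, l)\<in>splits n. \<Sum>i = 1..k.
    diamond scaleM (\<lambda>k \<alpha>s r us. \<eta> k (RB_word R r \<alpha>s us)) k i l r \<alpha>s ds us) = 0"
proof -
  have "(\<Sum>(k, l)\<in>splits n. \<Sum>i = 1..k.
      diamond scaleM (\<lambda>k \<alpha>s r us. \<eta> k (RB_word R r \<alpha>s us)) k i l r \<alpha>s ds us) =
    (\<Sum>(k, l)\<in>splits n. \<Sum>i = 1..k. scaleM (koszul_sign i ds)
      (\<eta> k (contract i l (mixed_op \<mu> \<eta> l) (RB_word R r \<alpha>s us))))"
    using assms by (intro sum.cong refl) (auto intro!: sum.cong diamond_RB)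
  also have "\<dots> = 0"
    using assms by (intro representation homogeneous_RB_word)
      (auto simp: M_count_RB_word intro: degree_R)
  finally show ?thesis .
qed

end

theorem theorem6p10:
  fixes scaleA :: "'k::field_char_0 \<Rightarrow> 'a::ab_group_add \<Rightarrow> 'a"
    and A :: "int \<Rightarrow> 'a set"
    and \<mu> :: "nat \<Rightarrow> 'a list \<Rightarrow> 'a"
    and scaleM :: "'k \<Rightarrow> 'm::ab_group_add \<Rightarrow> 'm"
    and M :: "int \<Rightarrow> 'm set"
    and \<eta> :: "nat \<Rightarrow> ('a + 'm) list \<Rightarrow> 'm"
    and R :: "'w::semigroup_mult \<Rightarrow> 'm \<Rightarrow> 'a"
  assumes "strict_homotopy_relative_RB_family_algebra scaleA A \<mu> scaleM M \<eta> R"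
  shows "Dend_infinity_family_algebra scaleM M (\<lambda>k \<alpha>s r us. \<eta> k (RB_word R r \<alpha>s us))"
proof -
  interpret strict_homotopy_relative_RB_family_algebra scaleA A \<mu> scaleM M \<eta> R
    by (fact assms)
  show ?thesis
    by unfold_locales (fact Hom_family_RB Dend_infinity_RB)+
qed

end
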